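(* Let $\mathcal{T}$ be a forest with components $T_1,T_2,\ldots,T_n$, such that each $T_i$ is a perfect tree. Let $T_1,\ldots,T_m$ be exactly those components whose arity is the highest among the arities of $T_1,\ldots,T_n$, let $h_i$ be the number of levels of $T_i$ for $i\in[m]$, and suppose $h_1\le h_2\le\cdots\le h_m$. If $h_i$ is even for every $i\in[m]$, let $\ell$ be any leaf of $T_m$; otherwise, let $j\in[m]$ be minimal such that $h_j$ is odd, and let $\ell$ be any leaf of $T_j$. Then for every positive integer $k$ and every $v\in V(\mathcal{T})$, $|\mathcal{I}_{\mathcal{T}}^k(v)|\le|\mathcal{I}_{\mathcal{T}}^k(\ell)|$.
   Context: For an integer $r\ge 2$, the perfect $r$-ary tree with $h$ levels is the rooted tree in which every non-leaf vertex has exactly $r$ children and which has exactly $r^{h-1}$ leaves, all at distance $h-1$ from the root; its arity is $r$, and its leaves are the vertices at distance $h-1$ from the root. A perfect tree is a perfect $r$-ary tree for some $r\ge2$. For a graph $G$, a set $I\subseteq V(G)$ is independent if no two vertices of $I$ are adjacent; $\mathcal{I}_G^k$ denotes the family of all independent sets of size $k$ in $G$, and for $v\in V(G)$, $\mathcal{I}_G^k(v)=\{A\in\mathcal{I}_G^k : v\in A\}$.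
   Formalization: A one-vertex component is perfect r-ary for every r ≥ 2, so its arity is ambiguous; it is always counted among the components of highest arity, since giving it a lower arity makes the claim false (K_1 with K_{1,3}, k = 2). *)

theory Defs
  imports Main
begin

text \<open>
  Simple graphs are developed from scratch: the trees and forests of the AFP entry Graph_Theory
  are those of digraphs, where both orientations of one edge already form a cycle.
\<close>

datatype 'a sgraph = SGraph (verts: "'a set") (edges: "'a set set")

definition simple_graph :: "'a sgraph \<Rightarrow> bool" where
  "simple_graph G \<longleftrightarrow> finite (verts G) \<and> (\<forall>e \<in> edges G. e \<subseteq> verts G \<and> card e = 2)"

definition adj :: "'a sgraph \<Rightarrow> 'a \<Rightarrow> 'a \<Rightarrow> bool" where
  "adj G u v \<longleftrightarrow> {u, v} \<in> edges G"

definition subgraph :: "'a sgraph \<Rightarrow> 'a sgraph \<Rightarrow> bool" where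
  "subgraph H G \<longleftrightarrow> simple_graph H \<and> verts H \<subseteq> verts G \<and> edges H \<subseteq> edges G"

definition walk :: "'a sgraph \<Rightarrow> 'a list \<Rightarrow> bool" where
  "walk G p \<longleftrightarrow> p \<noteq> [] \<and> set p \<subseteq> verts G \<and> successively (adj G) p"

definition graph_connected :: "'a sgraph \<Rightarrow> bool" where
  "graph_connected G \<longleftrightarrow>
     verts G \<noteq> {} \<and> (\<forall>u \<in> verts G. \<forall>v \<in> verts G. \<exists>p. walk G p \<and> hd p = u \<and> last p = v)"

definition graph_cycle :: "'a sgraph \<Rightarrow> 'a list \<Rightarrow> bool" where
  "graph_cycle G p \<longleftrightarrow> walk G p \<and> distinct p \<and> length p \<ge> 3 \<and> adj G (last p) (hd p)"

definition graph_forest :: "'a sgraph \<Rightarrow> bool" where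
  "graph_forest G \<longleftrightarrow> simple_graph G \<and> (\<nexists>p. graph_cycle G p)"

definition graph_tree :: "'a sgraph \<Rightarrow> bool" where
  "graph_tree G \<longleftrightarrow> graph_forest G \<and> graph_connected G"

definition graph_components :: "'a sgraph \<Rightarrow> 'a sgraph set" where
  "graph_components G =
     {H. subgraph H G \<and> graph_connected H \<and>
         (\<forall>H'. subgraph H' G \<and> graph_connected H' \<and> subgraph H H' \<longrightarrow> H' = H)}"

text \<open>Only meaningful for vertices joined by a walk.\<close>

definition graph_dist :: "'a sgraph \<Rightarrow> 'a \<Rightarrow> 'a \<Rightarrow> nat" where
  "graph_dist G u v = (LEAST d. \<exists>p. walk G p \<and> hd p = u \<and> last p = v \<and> length p = Suc d)"

definition children :: "'a sgraph \<Rightarrow> 'a \<Rightarrow> 'a \<Rightarrow> 'a set" where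
  "children G \<rho> v = {w \<in> verts G. adj G v w \<and> graph_dist G \<rho> w = Suc (graph_dist G \<rho> v)}"

definition leaves :: "'a sgraph \<Rightarrow> 'a \<Rightarrow> 'a set" where
  "leaves G \<rho> = {v \<in> verts G. children G \<rho> v = {}}"

text \<open>
  \<open>perfect_tree G \<rho> r h\<close>: the tree \<open>G\<close> with root \<open>\<rho>\<close> is the perfect \<open>r\<close>-ary tree with \<open>h\<close> levels.
  For \<open>h \<ge> 2\<close> the arity \<open>r\<close> is determined by \<open>G\<close>.  The tree with \<open>h = 1\<close> is a single vertex and
  is perfect \<open>r\<close>-ary for every \<open>r \<ge> 2\<close>, so ``has arity \<open>r\<close>'' is a relation and not a function.
\<close>

definition perfect_tree :: "'a sgraph \<Rightarrow> 'a \<Rightarrow> nat \<Rightarrow> nat \<Rightarrow> bool" where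
  "perfect_tree G \<rho> r h \<longleftrightarrow>
     graph_tree G \<and> \<rho> \<in> verts G \<and> r \<ge> 2 \<and> h \<ge> 1 \<and>
     (\<forall>v \<in> verts G - leaves G \<rho>. card (children G \<rho> v) = r) \<and>
     card (leaves G \<rho>) = r ^ (h - 1) \<and>
     leaves G \<rho> = {v \<in> verts G. graph_dist G \<rho> v = h - 1}"

definition indep_sets :: "'a sgraph \<Rightarrow> nat \<Rightarrow> 'a set set" where
  "indep_sets G k = {A. A \<subseteq> verts G \<and> card A = k \<and> pairwise (\<lambda>u w. \<not> adj G u w) A}"

definition indep_star :: "'a sgraph \<Rightarrow> nat \<Rightarrow> 'a \<Rightarrow> 'a set set" where
  "indep_star G k v = {A \<in> indep_sets G k. v \<in> A}"

end

theory Submission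
  imports Defs "HOL-Computational_Algebra.Polynomial"
begin

text \<open>
  Give an independent set \<open>A\<close> the weight \<open>x ^ card A\<close>; for \<open>x\<close> the indeterminate of \<open>\<nat>[x]\<close>, comparing
  weighted sums coefficientwise compares the numbers of sets of every size.  Every
  comparison holds because the larger side exceeds the smaller one by a sum of products, without
  any subtraction, hence in every commutative semiring with the preorder \<open>\<exists>d. q = p + d\<close>.

  Let \<open>P h\<close> be the sum over the independent sets of the perfect \<open>r\<close>-ary tree with \<open>h\<close> levels, and
  \<open>S h\<close> the sum over those that contain a given leaf.  Along the path from the leaf to the root, both
  obey the same transfer recursion, which alternates the sign of their cross products, so that
  \<open>S h / P h\<close> behaves like the convergents of a continued fraction: the shortest odd tree, or else the
  tallest even tree, is best.  For arities \<open>s < r\<close> the recursion reduces the comparison to trees with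
  at most three levels.

  Within one tree, the recursion reduces an arbitrary vertex to the root of its own subtree.  For
  root against leaf, exchange the two ends of the path joining them: the subtrees hanging off the
  path give each vertex a weight, and which of two vertices at mirror positions gains by a swap
  alternates along the path, just as a chain of forced swaps does.
\<close>

section \<open>The natural preorder of a commutative semiring\<close>

definition natural_le :: "'a::comm_semiring_1 \<Rightarrow> 'a \<Rightarrow> bool" (infix "\<preceq>" 50) where
  "p \<preceq> q \<longleftrightarrow> (\<exists>d. q = p + d)"

lemma natural_le_refl [simp]: "p \<preceq> p"
  unfolding natural_le_def by (rule exI[of _ 0]) simp

lemma natural_le_trans [trans]: "p \<preceq> q \<Longrightarrow> q \<preceq> s \<Longrightarrow> p \<preceq> s"
  unfolding natural_le_def by (metis add.assoc)

lemma zero_natural_le [simp]: "0 \<preceq> p"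
  by (simp add: natural_le_def)

lemma natural_le_add_self: "p \<preceq> p + q"
  unfolding natural_le_def by blast

lemma natural_le_add_mono: "p \<preceq> q \<Longrightarrow> p' \<preceq> q' \<Longrightarrow> p + p' \<preceq> q + q'"
proof -
  assume "p \<preceq> q" "p' \<preceq> q'"
  then obtain d d' where "q = p + d" "q' = p' + d'"
    by (auto simp: natural_le_def)
  then have "q + q' = (p + p') + (d + d')"
    by (simp only: ac_simps)
  then show ?thesis unfolding natural_le_def by blast
qed

lemma natural_le_mult_left: "p \<preceq> q \<Longrightarrow> c * p \<preceq> c * q"
  unfolding natural_le_def by (metis distrib_left)

lemma natural_le_mult_mono:
  assumes "p \<preceq> q" "p' \<preceq> q'"
  shows "p * p' \<preceq> q * q'"
proof -
  have "p * p' \<preceq> p * q'"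
    using assms(2) by (rule natural_le_mult_left)
  also have "p * q' \<preceq> q * q'"
    using natural_le_mult_left[OF assms(1), of q'] by (simp only: mult.commute)
  finally show ?thesis .
qed

lemma natural_le_power_mono: "p \<preceq> q \<Longrightarrow> p ^ n \<preceq> q ^ n"
  by (induction n) (auto intro: natural_le_mult_mono)

lemma coeff_mono:
  fixes p q :: "'a::{comm_semiring_1, canonically_ordered_monoid_add} poly"
  shows "p \<preceq> q \<Longrightarrow> coeff p i \<le> coeff q i"
  by (auto simp: natural_le_def le_iff_add)

definition parity_le :: "'a::comm_semiring_1 \<Rightarrow> nat \<Rightarrow> 'a \<Rightarrow> bool" ("(_ \<preceq>\<^bsub>_\<^esub> _)" [51, 0, 51] 50) where
  "p \<preceq>\<^bsub>n\<^esub> q \<longleftrightarrow> (if even n then p \<preceq> q else q \<preceq> p)"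

lemma parity_le_Suc [simp]: "p \<preceq>\<^bsub>Suc n\<^esub> q \<longleftrightarrow> q \<preceq>\<^bsub>n\<^esub> p"
  by (simp add: parity_le_def)

lemma parity_le_add_left: "p \<preceq>\<^bsub>n\<^esub> q \<Longrightarrow> c + p \<preceq>\<^bsub>n\<^esub> c + q"
  by (auto simp: parity_le_def intro: natural_le_add_mono split: if_splits)

lemma parity_le_mult_mono: "p \<preceq>\<^bsub>n\<^esub> q \<Longrightarrow> p' \<preceq>\<^bsub>n\<^esub> q' \<Longrightarrow> p * p' \<preceq>\<^bsub>n\<^esub> q * q'"
  by (auto simp: parity_le_def intro: natural_le_mult_mono split: if_splits)

lemma parity_le_mult_left: "p \<preceq>\<^bsub>n\<^esub> q \<Longrightarrow> c * p \<preceq>\<^bsub>n\<^esub> c * q"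
  by (rule parity_le_mult_mono) (simp add: parity_le_def)

lemma parity_le_power_mono: "p \<preceq>\<^bsub>n\<^esub> q \<Longrightarrow> p ^ j \<preceq>\<^bsub>n\<^esub> q ^ j"
  by (auto simp: parity_le_def intro: natural_le_power_mono split: if_splits)

section \<open>Independent sets of a weighted path\<close>

text \<open>
  A vertex \<open>t\<close> of the path has weight \<open>a t\<close> if it is unchosen and \<open>b t\<close> if it is chosen.  Along the
  path, \<open>K\<close> sums the weights of the independent sets and \<open>H\<close> those with the last vertex unchosen.
\<close>

definition path_transfer ::
  "(nat \<Rightarrow> 'a::comm_semiring_1) \<Rightarrow> (nat \<Rightarrow> 'a) \<Rightarrow> nat \<Rightarrow> (nat \<Rightarrow> 'a) \<Rightarrow> (nat \<Rightarrow> 'a) \<Rightarrow> bool" where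
  "path_transfer a b s K H \<longleftrightarrow>
     (\<forall>t\<ge>s. K (Suc t) = a t * K t + b t * H t \<and> H (Suc t) = a t * K t)"

lemma path_transferD:
  assumes "path_transfer a b s K H" "s \<le> t"
  shows "K (Suc t) = a t * K t + b t * H t" and "H (Suc t) = a t * K t"
  using assms by (auto simp: path_transfer_def)

lemma path_transfer_later: "path_transfer a b s K H \<Longrightarrow> s \<le> s' \<Longrightarrow> path_transfer a b s' K H"
  by (simp add: path_transfer_def)

lemma path_transfer_mono:
  assumes "path_transfer a b s K H" "path_transfer a b s K' H'"
    and "c * K s \<preceq> c' * K' s" "c * H s \<preceq> c' * H' s" and "s \<le> t"
  shows "c * K t \<preceq> c' * K' t" and "c * H t \<preceq> c' * H' t"
proof -
  have "c * K t \<preceq> c' * K' t \<and> c * H t \<preceq> c' * H' t"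
    using \<open>s \<le> t\<close>
  proof (induction t rule: dec_induct)
    case base
    then show ?case using assms(3,4) by simp
  next
    case (step t)
    note rec = path_transferD[OF assms(1) step.hyps(1)]
      and rec' = path_transferD[OF assms(2) step.hyps(1)]
    have "c * K (Suc t) = a t * (c * K t) + b t * (c * H t)" "c * H (Suc t) = a t * (c * K t)"
      "c' * K' (Suc t) = a t * (c' * K' t) + b t * (c' * H' t)" "c' * H' (Suc t) = a t * (c' * K' t)"
      unfolding rec rec' by (simp_all only: algebra_simps)
    then show ?case
      using step.IH by (simp add: natural_le_add_mono natural_le_mult_left)
  qed
  then show "c * K t \<preceq> c' * K' t" and "c * H t \<preceq> c' * H' t" by auto
qed

lemma path_transfer_mono_two:
  assumes "path_transfer a b s K H" "path_transfer a b s K' H'"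
    and "c * K s \<preceq> c' * K' s" "c * K (Suc s) \<preceq> c' * K' (Suc s)" and "s \<le> t"
  shows "c * K t \<preceq> c' * K' t"
proof (cases "t = s")
  case False
  note later = path_transfer_later[OF assms(1) le_SucI[OF order_refl]]
    path_transfer_later[OF assms(2) le_SucI[OF order_refl]]
  have "c * H (Suc s) \<preceq> c' * H' (Suc s)"
    using natural_le_mult_left[OF assms(3), of "a s"]
    by (simp add: path_transferD(2)[OF assms(1)] path_transferD(2)[OF assms(2)] mult.left_commute)
  moreover have "Suc s \<le> t"
    using False assms(5) by simp
  ultimately show ?thesis
    by (rule path_transfer_mono(1)[OF later assms(4)])
qed (use assms(3) in simp)

lemma path_transfer_cross:
  assumes "path_transfer a b s K H" "path_transfer a b s K' H'"
    and "K s * H' s \<preceq>\<^bsub>s\<^esub> H s * K' s" and "s \<le> t"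
  shows "K t * H' t \<preceq>\<^bsub>t\<^esub> H t * K' t"
  using \<open>s \<le> t\<close>
proof (induction t rule: dec_induct)
  case base
  then show ?case by (rule assms(3))
next
  case (step t)
  note rec = path_transferD[OF assms(1) step.hyps(1)]
    and rec' = path_transferD[OF assms(2) step.hyps(1)]
  have "K (Suc t) * H' (Suc t) = a t * (a t * K t * K' t + b t * (H t * K' t))"
    unfolding rec rec' by (simp only: algebra_simps)
  moreover have "H (Suc t) * K' (Suc t) = a t * (a t * K t * K' t + b t * (K t * H' t))"
    unfolding rec rec' by (simp only: algebra_simps)
  ultimately show ?case
    using step.IH by (simp add: parity_le_mult_left parity_le_add_left)
qed

context
  fixes a b :: "nat \<Rightarrow> 'a::comm_semiring_1"
begin

text \<open>
  The path on the vertices \<open>s, \<dots>, s + d - 1\<close>.  The parameter \<open>c\<close> describes the vertex before \<open>s\<close>: it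
  is \<open>1\<close> if that vertex is unchosen or missing, and \<open>0\<close> if it is chosen.
\<close>

fun path_sum :: "'a \<Rightarrow> nat \<Rightarrow> nat \<Rightarrow> 'a" and path_last_out :: "'a \<Rightarrow> nat \<Rightarrow> nat \<Rightarrow> 'a" where
  "path_sum c s 0 = 1"
| "path_sum c s (Suc d) = a (s + d) * path_sum c s d + b (s + d) * path_last_out c s d"
| "path_last_out c s 0 = c"
| "path_last_out c s (Suc d) = a (s + d) * path_sum c s d"

lemma path_transfer_eq_path_sum:
  assumes "path_transfer a b s K H" "H s = K s * c"
  shows "K (s + d) = K s * path_sum c s d" and "H (s + d) = K s * path_last_out c s d"
proof (induction d)
  case (Suc d)
  { case 1 show ?case using Suc path_transferD(1)[OF assms(1), of "s + d"] by (simp add: algebra_simps) }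
  { case 2 show ?case using Suc path_transferD(2)[OF assms(1), of "s + d"] by (simp add: algebra_simps) }
qed (use assms(2) in simp_all)

lemma path_sum_first:
  shows "path_sum c s (Suc d) = a s * path_sum 1 (Suc s) d + c * b s * path_sum 0 (Suc s) d"
    and "path_last_out c s (Suc d)
      = a s * path_last_out 1 (Suc s) d + c * b s * path_last_out 0 (Suc s) d"
proof (induction d)
  case (Suc d)
  { case 1 show ?case unfolding path_sum.simps(2)[of c s "Suc d"] Suc by (simp add: algebra_simps) }
  { case 2 show ?case unfolding path_last_out.simps(2)[of c s "Suc d"] Suc by (simp add: algebra_simps) }
qed (simp_all add: mult.commute)

context
  assumes alternating: "\<And>s t. s < t \<Longrightarrow> b t * a s \<preceq>\<^bsub>s\<^esub> a t * b s"
begin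

text \<open>The inner path starts one vertex later, so its comparison points the other way.\<close>

lemma path_swap_ends:
  "b (s + Suc d) * a s * path_last_out 1 (Suc s) d \<preceq>\<^bsub>s\<^esub> a (s + Suc d) * b s * path_sum 0 (Suc s) d"
proof (induction d arbitrary: s rule: induct_nat_012)
  case 0
  then show ?case using alternating[of s "Suc s"] by simp
next
  case 1
  then show ?case
    using parity_le_mult_left[OF alternating[of s "Suc (Suc s)"], of "a (Suc s)"]
    by (simp add: mult.commute)
next
  case (ge2 d)
  define s' t where "s' = Suc s" and "t = s + Suc (Suc d)"
  let ?both_out = "a s' * a t * path_sum 1 (Suc s') d"
  let ?last_in = "b t * a s' * path_last_out 1 (Suc s') d"
  let ?first_in = "a t * b s' * path_sum 0 (Suc s') d"
  have "path_last_out 1 s' (Suc (Suc d)) = a t * path_sum 1 s' (Suc d)"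
    by (simp add: s'_def t_def)
  then have last_out: "path_last_out 1 s' (Suc (Suc d)) = ?both_out + ?first_in"
    unfolding path_sum_first(1) by (simp add: algebra_simps)
  have "path_sum 0 s' (Suc (Suc d)) = a s' * path_sum 1 (Suc s') (Suc d)"
    unfolding path_sum_first(1)[of 0] by simp
  then have first_out: "path_sum 0 s' (Suc (Suc d)) = ?both_out + ?last_in"
    by (simp add: s'_def t_def algebra_simps)
  have "?first_in \<preceq>\<^bsub>s\<^esub> ?last_in"
    using ge2.IH(1)[of s'] by (simp add: s'_def t_def)
  then show ?case
    using last_out first_out alternating[of s "Suc t"]
    by (simp add: s'_def t_def parity_le_mult_mono parity_le_add_left
        del: path_sum.simps path_last_out.simps)
qed

lemma path_last_in_le_first_in:
  "b (Suc d) * path_last_out 1 0 (Suc d) \<preceq> b 0 * path_sum 0 1 (Suc d)"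
proof -
  let ?both_in = "b (Suc d) * b 0 * path_last_out 0 1 d"
  have "b (Suc d) * path_last_out 1 0 (Suc d)
      = ?both_in + b (0 + Suc d) * a 0 * path_last_out 1 (Suc 0) d"
    unfolding path_sum_first(2) by (simp add: algebra_simps)
  also have "\<dots> \<preceq> ?both_in + a (0 + Suc d) * b 0 * path_sum 0 (Suc 0) d"
    using path_swap_ends[of 0 d] by (intro natural_le_add_mono) (simp_all add: parity_le_def)
  also have "\<dots> = b 0 * path_sum 0 1 (Suc d)"
    by (simp add: algebra_simps)
  finally show ?thesis .
qed

end

end

section \<open>Recursions for perfect trees\<close>

context
  fixes x :: "'a::comm_semiring_1"
begin

text \<open>
  An independent set \<open>A\<close> has weight \<open>x ^ card A\<close>.  In the perfect \<open>r\<close>-ary tree with \<open>h\<close> levels,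
  \<open>tree_sum r h\<close> sums the weights of the independent sets and \<open>root_out_sum r h\<close> those without the
  root.  Levels are numbered from the leaves, which are at level \<open>1\<close>.  For a fixed vertex at level
  \<open>g\<close>, \<open>star_sum r g h\<close> and \<open>star_root_out_sum r g h\<close> keep only the sets that contain this vertex;
  they are \<open>0\<close> for \<open>h < g\<close>.
\<close>

fun tree_sum :: "nat \<Rightarrow> nat \<Rightarrow> 'a" and root_out_sum :: "nat \<Rightarrow> nat \<Rightarrow> 'a" where
  "tree_sum r 0 = 1"
| "tree_sum r (Suc h) = tree_sum r h ^ r + x * root_out_sum r h ^ r"
| "root_out_sum r 0 = 1"
| "root_out_sum r (Suc h) = tree_sum r h ^ r"

text \<open>
  Weights of a vertex at level \<open>Suc t\<close> on the path from the root to a fixed vertex: its \<open>r - 1\<close>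
  children off the path carry perfect trees with \<open>t\<close> levels.
\<close>

definition out_weight :: "nat \<Rightarrow> nat \<Rightarrow> 'a" where
  "out_weight r t = tree_sum r t ^ (r - 1)"

definition in_weight :: "nat \<Rightarrow> nat \<Rightarrow> 'a" where
  "in_weight r t = x * root_out_sum r t ^ (r - 1)"

fun star_sum :: "nat \<Rightarrow> nat \<Rightarrow> nat \<Rightarrow> 'a" and star_root_out_sum :: "nat \<Rightarrow> nat \<Rightarrow> nat \<Rightarrow> 'a" where
  "star_sum r g 0 = 0"
| "star_sum r g (Suc h) =
     (if Suc h = g then x * root_out_sum r h ^ r
      else out_weight r h * star_sum r g h + in_weight r h * star_root_out_sum r g h)"
| "star_root_out_sum r g 0 = 0"
| "star_root_out_sum r g (Suc h) = out_weight r h * star_sum r g h"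

abbreviation leaf_sum :: "nat \<Rightarrow> nat \<Rightarrow> 'a" where
  "leaf_sum r h \<equiv> star_sum r 1 h"

abbreviation path_transfer_tree :: "nat \<Rightarrow> nat \<Rightarrow> (nat \<Rightarrow> 'a) \<Rightarrow> (nat \<Rightarrow> 'a) \<Rightarrow> bool" where
  "path_transfer_tree r \<equiv> path_transfer (out_weight r) (in_weight r)"

lemma star_sum_below: "h < g \<Longrightarrow> star_sum r g h = 0"
  and star_root_out_sum_below: "h \<le> g \<Longrightarrow> star_root_out_sum r g h = 0"
  by (induction h) auto

lemma path_transfer_tree_sum:
  assumes "0 < r"
  shows "path_transfer_tree r s (tree_sum r) (root_out_sum r)"
  using assms by (simp add: path_transfer_def out_weight_def in_weight_def mult.assoc flip: power_Suc2)

lemma path_transfer_star_sum: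
  "0 < g \<Longrightarrow> g \<le> s \<Longrightarrow> path_transfer_tree r s (star_sum r g) (star_root_out_sum r g)"
  by (auto simp: path_transfer_def)

lemma tree_sum_parity:
  "s < t \<Longrightarrow> root_out_sum r t * tree_sum r s \<preceq>\<^bsub>s\<^esub> tree_sum r t * root_out_sum r s"
proof (induction s arbitrary: t)
  case 0
  then show ?case
    by (cases t) (simp_all add: parity_le_def natural_le_add_self)
next
  case (Suc s)
  then obtain u where t_Suc: "t = Suc u" "s < u" by (cases t) auto
  let ?P = "tree_sum r" and ?Q = "root_out_sum r"
  have "?Q t * ?P (Suc s) = ?Q t * ?Q (Suc s) + x * (?P u * ?Q s) ^ r"
    by (simp add: t_Suc power_mult_distrib algebra_simps)
  moreover have "?P t * ?Q (Suc s) = ?Q t * ?Q (Suc s) + x * (?Q u * ?P s) ^ r"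
    by (simp add: t_Suc power_mult_distrib algebra_simps)
  ultimately show ?case
    using Suc.IH[OF t_Suc(2)] by (simp add: parity_le_add_left parity_le_mult_left parity_le_power_mono)
qed

lemma weight_parity:
  assumes "s < t"
  shows "in_weight r t * out_weight r s \<preceq>\<^bsub>s\<^esub> out_weight r t * in_weight r s"
proof -
  have "in_weight r t * out_weight r s = x * (root_out_sum r t * tree_sum r s) ^ (r - 1)"
    "out_weight r t * in_weight r s = x * (tree_sum r t * root_out_sum r s) ^ (r - 1)"
    by (simp_all add: in_weight_def out_weight_def power_mult_distrib algebra_simps)
  then show ?thesis
    using tree_sum_parity[OF assms] by (simp add: parity_le_mult_left parity_le_power_mono)
qed

section \<open>A leaf against another vertex of the same tree\<close>

lemma root_star_le_leaf:
  assumes "0 < r" "0 < g"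
  shows "star_sum r g g \<preceq> leaf_sum r g"
proof (cases "g = 1")
  case False
  define d where "d = g - 2"
  have g_Suc: "g = Suc (Suc d)"
    using False assms(2) by (simp add: d_def)
  let ?a = "out_weight r" and ?b = "in_weight r"
  have "star_sum r g g = ?b (Suc d) * root_out_sum r (Suc d)"
    using assms(1) by (simp add: g_Suc in_weight_def mult.assoc flip: power_Suc2 del: root_out_sum.simps)
  also have "\<dots> = ?b (Suc d) * path_last_out ?a ?b 1 0 (Suc d)"
    using path_transfer_eq_path_sum(2)[OF path_transfer_tree_sum[OF assms(1), of 0], of 1 "Suc d"] by simp
  also have "\<dots> \<preceq> ?b 0 * path_sum ?a ?b 0 1 (Suc d)"
    by (intro path_last_in_le_first_in weight_parity)
  also have "\<dots> = leaf_sum r g"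
    using path_transfer_eq_path_sum(1)[OF path_transfer_star_sum[of 1 1 r], of 0 "Suc d"]
    by (simp add: g_Suc in_weight_def del: path_sum.simps)
  finally show ?thesis .
qed simp

lemma star_sum_le_leaf_sum:
  assumes "0 < r" "0 < g" "g \<le> h"
  shows "star_sum r g h \<preceq> leaf_sum r h"
proof -
  have "1 * star_sum r g h \<preceq> 1 * leaf_sum r h"
    by (rule path_transfer_mono(1)[OF path_transfer_star_sum[of g g r] path_transfer_star_sum[of 1 g r]])
      (use assms root_star_le_leaf star_root_out_sum_below[of g g r] in auto)
  then show ?thesis by simp
qed

section \<open>Leaves of two perfect trees\<close>

lemma leaf_sum_cross:
  assumes "0 < r" "0 < h"
  shows "leaf_sum r h * root_out_sum r h \<preceq>\<^bsub>h\<^esub> star_root_out_sum r 1 h * tree_sum r h"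
  by (rule path_transfer_cross[OF path_transfer_star_sum[of 1 1 r] path_transfer_tree_sum[OF assms(1)]])
    (use assms(2) in \<open>simp_all add: parity_le_def\<close>)

lemma leaf_sum_same_arity:
  assumes "0 < r" "0 < h" "h \<le> h'"
  shows "leaf_sum r h * tree_sum r h' \<preceq>\<^bsub>h\<^esub> leaf_sum r h' * tree_sum r h"
proof -
  note star = path_transfer_star_sum[of 1 h r] and tree = path_transfer_tree_sum[OF assms(1), of h]
  have cross: "leaf_sum r h * root_out_sum r h \<preceq>\<^bsub>h\<^esub> tree_sum r h * star_root_out_sum r 1 h"
    using leaf_sum_cross[OF assms(1,2)] by (simp only: mult.commute)
  show ?thesis
  proof (cases "even h")
    case True
    have "leaf_sum r h * tree_sum r h' \<preceq> tree_sum r h * leaf_sum r h'"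
      by (rule path_transfer_mono(1)[OF tree star])
        (use cross assms \<open>even h\<close> in \<open>simp_all add: parity_le_def mult.commute\<close>)
    then show ?thesis
      using True by (simp add: parity_le_def mult.commute)
  next
    case False
    have "tree_sum r h * leaf_sum r h' \<preceq> leaf_sum r h * tree_sum r h'"
      by (rule path_transfer_mono(1)[OF star tree])
        (use cross assms \<open>odd h\<close> in \<open>simp_all add: parity_le_def mult.commute\<close>)
    then show ?thesis
      using False by (simp add: parity_le_def mult.commute)
  qed
qed

text \<open>From worst to best: the even heights in increasing order, then the odd heights in decreasing order.\<close>

definition leaf_height_le :: "nat \<Rightarrow> nat \<Rightarrow> bool" where
  "leaf_height_le g h \<longleftrightarrow> g = h \<or> (g < h \<and> even g) \<or> (h < g \<and> odd h)"

lemma leaf_sum_height_mono: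
  assumes "0 < r" "0 < g" "0 < h" "leaf_height_le g h"
  shows "leaf_sum r g * tree_sum r h \<preceq> leaf_sum r h * tree_sum r g"
  using assms leaf_sum_same_arity[of r g h] leaf_sum_same_arity[of r h g]
  by (auto simp: leaf_height_le_def parity_le_def)

lemma natural_le_cross:
  assumes "p \<preceq> w * q"
  shows "p * v * (w * y + z) \<preceq> w * v * (p * y + q * z)"
proof -
  have "p * v * (w * y + z) = p * v * w * y + v * z * p"
    by (simp only: algebra_simps)
  also have "\<dots> \<preceq> p * v * w * y + v * z * (w * q)"
    using assms by (intro natural_le_add_mono natural_le_mult_left natural_le_refl)
  also have "\<dots> = w * v * (p * y + q * z)"
    by (simp only: algebra_simps)
  finally show ?thesis .
qed

context
  fixes s r :: nat
  assumes less_arity: "0 < s" "s < r"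
begin

lemma one_plus_le_power_diff: "1 + x \<preceq> (1 + x) ^ (r - s)"
proof -
  have "1 \<preceq> (1 + x) ^ (r - s - 1)"
    using natural_le_power_mono[OF natural_le_add_self[of 1 x]] by simp
  then have "(1 + x) * 1 \<preceq> (1 + x) * (1 + x) ^ (r - s - 1)"
    by (rule natural_le_mult_left)
  moreover have "r - s = Suc (r - s - 1)"
    using less_arity by simp
  ultimately show ?thesis
    by (metis mult.right_neutral power_Suc)
qed

lemma sums_level_2_less_arity:
  "tree_sum r 2 = (1 + x) ^ (r - s) * (1 + x) ^ s + x"
  "leaf_sum r 2 = (1 + x) ^ (r - s) * leaf_sum s 2"
proof -
  have "r = (r - s) + s" "r - 1 = (r - s) + (s - 1)"
    using less_arity by simp_all
  then have "(1 + x) ^ r = (1 + x) ^ (r - s) * (1 + x) ^ s"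
    "(1 + x) ^ (r - 1) = (1 + x) ^ (r - s) * (1 + x) ^ (s - 1)"
    by (metis power_add)+
  then show "tree_sum r 2 = (1 + x) ^ (r - s) * (1 + x) ^ s + x"
    "leaf_sum r 2 = (1 + x) ^ (r - s) * leaf_sum s 2"
    by (simp_all add: numeral_2_eq_2 out_weight_def mult.assoc)
qed

lemma leaf_sum_less_arity_low:
  "leaf_sum s 2 * tree_sum r 2 \<preceq> leaf_sum r 2 * tree_sum s 2"
  "leaf_sum s 3 * tree_sum r 2 \<preceq> leaf_sum r 2 * tree_sum s 3"
proof -
  define w where "w = (1 + x) ^ (r - s)"
  let ?Y = "(1 + x) ^ s" and ?A = "out_weight s 2" and ?B = "in_weight s 2"
  have base_le_w: "1 + x \<preceq> w"
    unfolding w_def by (rule one_plus_le_power_diff)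
  have sums_r_2: "tree_sum r 2 = w * ?Y + x" "leaf_sum r 2 = w * leaf_sum s 2"
    unfolding w_def by (rule sums_level_2_less_arity)+
  have sums_s_2: "tree_sum s 2 = ?Y + x" "root_out_sum s 2 = ?Y"
    by (simp_all add: numeral_2_eq_2)
  have sums_s_3: "leaf_sum s 3 = (?A + ?B) * leaf_sum s 2" "tree_sum s 3 = (?A + ?B) * ?Y + ?A * x"
    using path_transferD(1)[OF path_transfer_star_sum[of 1 2 s], of 2]
      path_transferD(1)[OF path_transfer_tree_sum[OF less_arity(1)], of 0 2] sums_s_2
    by (simp_all add: numeral_3_eq_3 numeral_2_eq_2 algebra_simps)
  show "leaf_sum s 2 * tree_sum r 2 \<preceq> leaf_sum r 2 * tree_sum s 2"
    unfolding sums_r_2 sums_s_2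
    using natural_le_cross[of 1 w 1 "leaf_sum s 2"] natural_le_trans[OF natural_le_add_self base_le_w]
    by simp
  have "?B \<preceq> x * ?A"
    unfolding in_weight_def out_weight_def sums_s_2
    by (intro natural_le_mult_left natural_le_power_mono natural_le_add_self)
  then have "?A + ?B \<preceq> ?A + x * ?A"
    by (intro natural_le_add_mono natural_le_refl)
  also have "\<dots> = (1 + x) * ?A"
    by (simp add: distrib_right)
  also have "\<dots> \<preceq> w * ?A"
    using base_le_w by (intro natural_le_mult_mono natural_le_refl)
  finally show "leaf_sum s 3 * tree_sum r 2 \<preceq> leaf_sum r 2 * tree_sum s 3"
    unfolding sums_r_2 sums_s_3 by (rule natural_le_cross)
qed

lemma leaf_sum_less_arity:
  assumes "2 \<le> g" "1 \<le> h"
  shows "leaf_sum s g * tree_sum r h \<preceq> leaf_sum r h * tree_sum s g"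
proof -
  have "0 < r" using less_arity by simp
  have "leaf_sum s 1 * tree_sum s g \<preceq>\<^bsub>1\<^esub> leaf_sum s g * tree_sum s 1"
    using leaf_sum_same_arity[OF less_arity(1), of 1 g] assms(1) by simp
  then have level_1: "leaf_sum s g * tree_sum r 1 \<preceq> tree_sum s g * leaf_sum r 1"
    by (simp add: mult.commute parity_le_def)
  have "tree_sum r 2 * leaf_sum s g \<preceq> leaf_sum r 2 * tree_sum s g"
    by (rule path_transfer_mono_two[OF path_transfer_star_sum[of 1 2 s]
          path_transfer_tree_sum[OF less_arity(1)]])
      (use leaf_sum_less_arity_low assms(1) in
        \<open>simp_all add: mult.commute numeral_3_eq_3 numeral_2_eq_2 del: star_sum.simps tree_sum.simps\<close>)
  then have level_2: "leaf_sum s g * tree_sum r 2 \<preceq> tree_sum s g * leaf_sum r 2"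
    by (simp only: mult.commute)
  have "leaf_sum s g * tree_sum r h \<preceq> tree_sum s g * leaf_sum r h"
    by (rule path_transfer_mono_two[OF path_transfer_tree_sum[OF \<open>0 < r\<close>]
          path_transfer_star_sum[of 1 1 r]])
      (use level_1 level_2 assms(2) in \<open>simp_all add: numeral_2_eq_2 del: star_sum.simps tree_sum.simps\<close>)
  then show ?thesis
    by (simp only: mult.commute)
qed

end

text \<open>A single vertex is perfect for every arity, so a smaller arity loses only for \<open>2 \<le> g\<close>.\<close>

definition leaf_le :: "nat \<Rightarrow> nat \<Rightarrow> nat \<Rightarrow> nat \<Rightarrow> bool" where
  "leaf_le s g r h \<longleftrightarrow> s = r \<and> leaf_height_le g h \<or> s < r \<and> 2 \<le> g"

lemma leaf_sum_mono:
  assumes "0 < s" "0 < r" "0 < g" "0 < h" "leaf_le s g r h"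
  shows "leaf_sum s g * tree_sum r h \<preceq> leaf_sum r h * tree_sum s g"
  using assms leaf_sum_height_mono[of r g h] leaf_sum_less_arity[of s r g h] by (auto simp: leaf_le_def)

end

section \<open>Weighted sums over independent sets\<close>

definition indep_family :: "('b \<Rightarrow> 'b \<Rightarrow> bool) \<Rightarrow> 'b set \<Rightarrow> 'b set \<Rightarrow> 'b set set" where
  "indep_family E U C = {A. C \<subseteq> A \<and> A \<subseteq> U \<and> pairwise (\<lambda>u w. \<not> E u w) A}"

definition indep_sum :: "'a::comm_semiring_1 \<Rightarrow> ('b \<Rightarrow> 'b \<Rightarrow> bool) \<Rightarrow> 'b set \<Rightarrow> 'b set \<Rightarrow> 'a" where
  "indep_sum x E U C = (\<Sum>A\<in>indep_family E U C. x ^ card A)"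

definition separated :: "('b \<Rightarrow> 'b \<Rightarrow> bool) \<Rightarrow> 'b set \<Rightarrow> 'b set \<Rightarrow> bool" where
  "separated E U W \<longleftrightarrow> U \<inter> W = {} \<and> (\<forall>u\<in>U. \<forall>w\<in>W. \<not> E u w \<and> \<not> E w u)"

lemma separated_subset: "separated E U W \<Longrightarrow> U' \<subseteq> U \<Longrightarrow> W' \<subseteq> W \<Longrightarrow> separated E U' W'"
  unfolding separated_def by blast

lemma separated_UN: "separated E U (\<Union>i\<in>I. W i) \<longleftrightarrow> (\<forall>i\<in>I. separated E U (W i))"
  unfolding separated_def by blast

lemma finite_indep_family: "finite U \<Longrightarrow> finite (indep_family E U C)"
  by (rule finite_subset[of _ "Pow U"]) (auto simp: indep_family_def)

lemma coeff_indep_sum_X: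
  assumes "finite U"
  shows "coeff (indep_sum (monom 1 1) E U C) k = of_nat (card {A \<in> indep_family E U C. card A = k})"
  using finite_indep_family[OF assms]
  by (simp add: indep_sum_def monom_power coeff_sum sum.If_cases Int_def)

lemma indep_sum_cong:
  assumes "\<And>u w. u \<in> U \<Longrightarrow> w \<in> U \<Longrightarrow> E u w \<longleftrightarrow> E' u w"
  shows "indep_sum x E U C = indep_sum x E' U C"
proof -
  have "indep_family E U C = indep_family E' U C"
    using assms unfolding indep_family_def pairwise_def by blast
  then show ?thesis by (simp add: indep_sum_def)
qed

lemma indep_sum_empty [simp]: "indep_sum x E {} {} = 1"
proof -
  have "indep_family E {} {} = {{}}" by (auto simp: indep_family_def)
  then show ?thesis by (simp add: indep_sum_def)
qed

lemma indep_sum_not_subset: "\<not> C \<subseteq> U \<Longrightarrow> indep_sum x E U C = 0"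
proof -
  assume "\<not> C \<subseteq> U"
  then have "indep_family E U C = {}" by (auto simp: indep_family_def)
  then show ?thesis by (simp add: indep_sum_def)
qed

lemma indep_sum_split:
  assumes "finite U" "a \<notin> C"
  shows "indep_sum x E U C = indep_sum x E (U - {a}) C + indep_sum x E U (insert a C)"
proof -
  have "indep_family E U C = indep_family E (U - {a}) C \<union> indep_family E U (insert a C)"
    using assms(2) by (auto simp: indep_family_def)
  moreover have "indep_family E (U - {a}) C \<inter> indep_family E U (insert a C) = {}"
    by (auto simp: indep_family_def)
  ultimately show ?thesis
    using assms by (simp add: indep_sum_def sum.union_disjoint finite_indep_family)
qed

lemma indep_family_insert:
  assumes "a \<in> U" "a \<notin> C" "symp E"
  shows "indep_family E U (insert a C) = insert a ` indep_family E (U - insert a {w. E a w}) C"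
    (is "?L = insert a ` ?R")
proof
  show "?L \<subseteq> insert a ` ?R"
  proof
    fix A assume "A \<in> ?L"
    then have "A = insert a (A - {a})" "A - {a} \<in> ?R"
      using assms(2) by (auto simp: indep_family_def pairwise_def)
    then show "A \<in> insert a ` ?R" by blast
  qed
  show "insert a ` ?R \<subseteq> ?L"
    using assms(1) by (auto simp: indep_family_def pairwise_insert) (use assms(3) in \<open>blast dest: sympD\<close>)+
qed

lemma indep_sum_insert:
  assumes "finite U" "a \<in> U" "a \<notin> C" "symp E"
  shows "indep_sum x E U (insert a C) = x * indep_sum x E (U - insert a {w. E a w}) C"
proof -
  let ?R = "indep_family E (U - insert a {w. E a w}) C"
  have "inj_on (insert a) ?R"
    by (auto simp: inj_on_def indep_family_def)
  moreover have "card (insert a A) = Suc (card A)" if "A \<in> ?R" for A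
  proof -
    have "A \<subseteq> U" "a \<notin> A" using that by (auto simp: indep_family_def)
    then show ?thesis using assms(1) finite_subset by fastforce
  qed
  ultimately show ?thesis
    by (simp add: indep_sum_def indep_family_insert[OF assms(2-4)] sum.reindex sum_distrib_left)
qed

lemma bij_betw_indep_family_Un:
  assumes "separated E U W" "C \<inter> W = {}"
  shows "bij_betw (\<lambda>(A, B). A \<union> B) (indep_family E U C \<times> indep_family E W {}) (indep_family E (U \<union> W) C)"
    (is "bij_betw _ ?I _")
proof (rule bij_betw_byWitness[where f' = "\<lambda>A. (A \<inter> U, A \<inter> W)"])
  show "\<forall>p\<in>?I. (\<lambda>A. (A \<inter> U, A \<inter> W)) ((\<lambda>(A, B). A \<union> B) p) = p"
    using assms(1) by (auto simp: indep_family_def separated_def)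
  show "\<forall>A\<in>indep_family E (U \<union> W) C. (\<lambda>(A, B). A \<union> B) (A \<inter> U, A \<inter> W) = A"
    by (auto simp: indep_family_def)
  show "(\<lambda>(A, B). A \<union> B) ` ?I \<subseteq> indep_family E (U \<union> W) C"
    using assms(1) unfolding indep_family_def pairwise_def separated_def by clarsimp blast
  show "(\<lambda>A. (A \<inter> U, A \<inter> W)) ` indep_family E (U \<union> W) C \<subseteq> ?I"
    using assms(2) by (auto simp: indep_family_def pairwise_def)
qed

lemma indep_sum_Un:
  assumes "finite U" "finite W" "separated E U W" "C \<inter> W = {}"
  shows "indep_sum x E (U \<union> W) C = indep_sum x E U C * indep_sum x E W {}"
proof -
  let ?I = "indep_family E U C \<times> indep_family E W {}"
  have "indep_sum x E (U \<union> W) C = (\<Sum>(A, B)\<in>?I. x ^ card (A \<union> B))"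
    using sum.reindex_bij_betw[OF bij_betw_indep_family_Un[OF assms(3,4)], of "\<lambda>A. x ^ card A"]
    by (simp add: indep_sum_def case_prod_unfold)
  also have "\<dots> = (\<Sum>(A, B)\<in>?I. x ^ card A * x ^ card B)"
  proof (rule sum.cong[OF refl], clarify)
    fix A B assume "A \<in> indep_family E U C" "B \<in> indep_family E W {}"
    then have "A \<subseteq> U" "B \<subseteq> W" by (auto simp: indep_family_def)
    then have "card (A \<union> B) = card A + card B"
      using assms(1-3) by (intro card_Un_disjoint) (auto simp: separated_def intro: finite_subset)
    then show "x ^ card (A \<union> B) = x ^ card A * x ^ card B"
      by (simp add: power_add)
  qed
  also have "\<dots> = indep_sum x E U C * indep_sum x E W {}"
    by (simp add: indep_sum_def sum_product sum.cartesian_product)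
  finally show ?thesis .
qed

lemma indep_sum_UN:
  assumes "finite I" "\<And>i. i \<in> I \<Longrightarrow> finite (U i)" "pairwise (\<lambda>i j. separated E (U i) (U j)) I"
  shows "indep_sum x E (\<Union>i\<in>I. U i) {} = (\<Prod>i\<in>I. indep_sum x E (U i) {})"
  using assms
proof (induction I rule: finite_induct)
  case (insert i I)
  have "separated E (U i) (\<Union>i\<in>I. U i)"
    using insert.hyps(2) insert.prems(2) by (auto simp: separated_UN pairwise_insert)
  then have "indep_sum x E (U i \<union> (\<Union>i\<in>I. U i)) {} = indep_sum x E (U i) {} * indep_sum x E (\<Union>i\<in>I. U i) {}"
    using insert by (intro indep_sum_Un) auto
  then show ?case
    using insert by (simp add: pairwise_insert)
qed simp

lemma indep_sum_UN_star:
  assumes "finite I" "\<And>i. i \<in> I \<Longrightarrow> finite (U i)" "pairwise (\<lambda>i j. separated E (U i) (U j)) I"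
    and "i \<in> I" "\<And>j. j \<in> I \<Longrightarrow> j \<noteq> i \<Longrightarrow> v \<notin> U j"
  shows "indep_sum x E (\<Union>i\<in>I. U i) {v} = indep_sum x E (U i) {v} * (\<Prod>j\<in>I - {i}. indep_sum x E (U j) {})"
proof -
  have "separated E (U i) (\<Union>j\<in>I - {i}. U j)"
    using assms(3,4) by (auto simp: separated_UN dest: pairwiseD)
  moreover have "(\<Union>i\<in>I. U i) = U i \<union> (\<Union>j\<in>I - {i}. U j)"
    using assms(4) by auto
  ultimately have "indep_sum x E (\<Union>i\<in>I. U i) {v}
      = indep_sum x E (U i) {v} * indep_sum x E (\<Union>j\<in>I - {i}. U j) {}"
    using assms by (simp add: indep_sum_Un)
  also have "indep_sum x E (\<Union>j\<in>I - {i}. U j) {} = (\<Prod>j\<in>I - {i}. indep_sum x E (U j) {})"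
    using assms by (intro indep_sum_UN) (auto intro: pairwise_subset)
  finally show ?thesis .
qed

abbreviation graph_sum :: "'a::comm_semiring_1 \<Rightarrow> 'b sgraph \<Rightarrow> 'b set \<Rightarrow> 'a" where
  "graph_sum x G \<equiv> indep_sum x (adj G) (verts G)"

section \<open>Distances in rooted trees\<close>

lemma adj_commute: "adj G u v \<longleftrightarrow> adj G v u"
  by (simp add: adj_def insert_commute)

lemma symp_adj: "symp (adj G)"
  by (rule sympI) (simp add: adj_commute)

lemma adj_verts: "simple_graph G \<Longrightarrow> adj G u v \<Longrightarrow> u \<in> verts G \<and> v \<in> verts G"
  by (auto simp: simple_graph_def adj_def)

lemma adj_neq: "simple_graph G \<Longrightarrow> adj G u v \<Longrightarrow> u \<noteq> v"
  by (fastforce simp: simple_graph_def adj_def)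

lemma walk_snoc: "p \<noteq> [] \<Longrightarrow> walk G (p @ [v]) \<longleftrightarrow> walk G p \<and> v \<in> verts G \<and> adj G (last p) v"
  by (auto simp: walk_def successively_append_iff)

lemma walk_Cons: "p \<noteq> [] \<Longrightarrow> walk G (v # p) \<longleftrightarrow> walk G p \<and> v \<in> verts G \<and> adj G v (hd p)"
  by (auto simp: walk_def successively_Cons)

locale rooted_tree =
  fixes T :: "'a sgraph" and \<rho> :: 'a
  assumes tree: "graph_tree T" and root: "\<rho> \<in> verts T"
begin

abbreviation dist :: "'a \<Rightarrow> nat" where
  "dist \<equiv> graph_dist T \<rho>"

lemma simple: "simple_graph T"
  using tree by (simp add: graph_tree_def graph_forest_def)

lemma finite_verts: "finite (verts T)"
  using simple by (simp add: simple_graph_def)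

lemma acyclic: "\<not> graph_cycle T p"
  using tree by (auto simp: graph_tree_def graph_forest_def)

lemma geodesic:
  assumes "v \<in> verts T"
  obtains p where "walk T p" "hd p = \<rho>" "last p = v" "length p = Suc (dist v)"
proof -
  obtain p where walk: "walk T p" "hd p = \<rho>" "last p = v"
    using tree root assms unfolding graph_tree_def graph_connected_def by blast
  then have "length p = Suc (length p - 1)"
    by (cases p) (auto simp: walk_def)
  then have "\<exists>d p. walk T p \<and> hd p = \<rho> \<and> last p = v \<and> length p = Suc d"
    using walk by blast
  from LeastI_ex[OF this] show ?thesis
    using that unfolding graph_dist_def by blast
qed

lemma dist_le_walk: "walk T p \<Longrightarrow> hd p = \<rho> \<Longrightarrow> length p = Suc d \<Longrightarrow> dist (last p) \<le> d"
  unfolding graph_dist_def by (rule Least_le) blast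

lemma dist_root [simp]: "dist \<rho> = 0"
  using dist_le_walk[of "[\<rho>]" 0] root by (simp add: walk_def)

lemma dist_eq_0: "v \<in> verts T \<Longrightarrow> dist v = 0 \<Longrightarrow> v = \<rho>"
  by (metis geodesic length_0_conv length_Suc_conv last.simps list.sel(1))

lemma dist_adj_le:
  assumes "adj T u v"
  shows "dist v \<le> Suc (dist u)"
proof -
  have ends: "u \<in> verts T" "v \<in> verts T" using adj_verts[OF simple assms] by auto
  obtain p where walk: "walk T p" "hd p = \<rho>" "last p = u" "length p = Suc (dist u)"
    using geodesic[OF ends(1)] by blast
  then have "p \<noteq> []" by auto
  then show ?thesis
    using walk ends assms dist_le_walk[of "p @ [v]"] by (simp add: walk_snoc)
qed

lemma parent_exists:
  assumes "v \<in> verts T" "v \<noteq> \<rho>"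
  obtains u where "u \<in> verts T" "v \<in> children T \<rho> u"
proof -
  obtain p where walk: "walk T p" "hd p = \<rho>" "last p = v" "length p = Suc (dist v)"
    using geodesic[OF assms(1)] by blast
  then obtain q where snoc: "p = q @ [v]"
    by (metis append_butlast_last_id length_0_conv nat.distinct(1))
  with walk assms have "q \<noteq> []" by auto
  with walk snoc have init: "walk T q" "adj T (last q) v" "hd q = \<rho>" "length q = dist v"
    by (auto simp: walk_snoc)
  then have "dist (last q) \<le> length q - 1"
    using \<open>q \<noteq> []\<close> by (intro dist_le_walk) (cases q; simp)+
  moreover have "dist v \<le> Suc (dist (last q))"
    using dist_adj_le init by blast
  ultimately have "dist v = Suc (dist (last q))"
    using init \<open>q \<noteq> []\<close> by (cases q) auto
  then show ?thesis
    using that[of "last q"] init assms(1) adj_verts[OF simple] by (auto simp: children_def)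
qed

lemma neighbour_towards_root:
  assumes "v \<in> verts T" "dist v = Suc n"
  obtains w where "w \<in> verts T" "adj T w v" "dist w = n"
proof -
  have "v \<noteq> \<rho>" using assms(2) dist_root by (metis nat.distinct(1))
  then obtain w where "w \<in> verts T" "v \<in> children T \<rho> w"
    using parent_exists[OF assms(1)] by blast
  then show ?thesis using that assms(2) by (simp add: children_def)
qed

lemma verts_induct [consumes 1, case_names root child]:
  assumes "v \<in> verts T" "P \<rho>"
    and "\<And>u v. u \<in> verts T \<Longrightarrow> P u \<Longrightarrow> v \<in> children T \<rho> u \<Longrightarrow> P v"
  shows "P v"
  using assms(1)
proof (induction "dist v" arbitrary: v rule: less_induct)
  case less
  show ?case
  proof (cases "v = \<rho>")
    case False
    then obtain u where parent: "u \<in> verts T" "v \<in> children T \<rho> u"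
      using parent_exists[OF less.prems] by blast
    then have "P u" using less.hyps by (simp add: children_def)
    then show ?thesis by (rule assms(3)[OF parent(1) _ parent(2)])
  qed (simp add: assms(2))
qed

text \<open>Otherwise both ends could be prolonged towards the root until they meet in a cycle.\<close>

lemma no_path_above:
  assumes "walk T p" "distinct p" "hd p \<noteq> last p"
    and "dist (hd p) = n" "dist (last p) = n" "\<forall>x\<in>set p. n \<le> dist x"
  shows False
  using assms
proof (induction n arbitrary: p)
  case 0
  then have "hd p \<in> verts T" "last p \<in> verts T" by (auto simp: walk_def)
  then show ?case using dist_eq_0 0 by metis
next
  case (Suc n)
  have ends: "p \<noteq> []" "hd p \<in> verts T" "last p \<in> verts T"
    using Suc.prems(1) by (auto simp: walk_def)
  obtain w where parent: "w \<in> verts T" "adj T w (hd p)" "dist w = n"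
    using neighbour_towards_root[OF ends(2) Suc.prems(4)] by blast
  obtain w' where parent': "w' \<in> verts T" "adj T w' (last p)" "dist w' = n"
    using neighbour_towards_root[OF ends(3) Suc.prems(5)] by blast
  have new: "w \<notin> set p" "w' \<notin> set p"
    using Suc.prems(6) parent(3) parent'(3) by auto
  have walk: "walk T (w # p)"
    using Suc.prems(1) parent ends(1) by (simp add: walk_Cons)
  show ?case
  proof (cases "w = w'")
    case True
    have "2 \<le> length p"
      using ends(1) Suc.prems(3) by (cases p rule: remdups_adj.cases) auto
    then have "graph_cycle T (w # p)"
      using walk Suc.prems(2) new parent' True ends(1) by (simp add: graph_cycle_def adj_commute)
    then show ?thesis using acyclic by blast
  next
    case False
    have "walk T (w # p @ [w'])"
      using walk parent' ends(1) walk_snoc[of "w # p" T w'] by (simp add: adj_commute)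
    then show ?thesis
      using Suc.IH[of "w # p @ [w']"] Suc.prems(2,6) new False parent parent' by fastforce
  qed
qed

lemma dist_adj_neq:
  assumes "adj T u w"
  shows "dist u \<noteq> dist w"
  using no_path_above[of "[u, w]" "dist w"] assms adj_verts[OF simple assms] adj_neq[OF simple assms]
  by (auto simp: walk_def)

lemma parent_unique:
  assumes "w \<in> children T \<rho> u" "w \<in> children T \<rho> u'"
  shows "u = u'"
proof (rule ccontr)
  assume "u \<noteq> u'"
  moreover have "u \<noteq> w" "u' \<noteq> w"
    using assms by (auto simp: children_def)
  ultimately show False
    using no_path_above[of "[u, w, u']" "dist u"] assms adj_verts[OF simple]
    by (auto simp: walk_def children_def adj_commute)
qed

lemma adj_iff_children: "adj T u w \<longleftrightarrow> w \<in> children T \<rho> u \<or> u \<in> children T \<rho> w"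
proof
  assume uw: "adj T u w"
  then have "adj T w u" by (simp add: adj_commute)
  then have "dist w = Suc (dist u) \<or> dist u = Suc (dist w)"
    using dist_adj_neq[OF uw] dist_adj_le[OF uw] dist_adj_le[of w u] by linarith
  then show "w \<in> children T \<rho> u \<or> u \<in> children T \<rho> w"
    using uw \<open>adj T w u\<close> adj_verts[OF simple uw] by (auto simp: children_def)
qed (auto simp: children_def adj_commute)

lemma children_verts: "w \<in> children T \<rho> u \<Longrightarrow> w \<in> verts T"
  by (simp add: children_def)

lemma dist_children: "w \<in> children T \<rho> u \<Longrightarrow> dist w = Suc (dist u)"
  by (simp add: children_def)

lemma finite_children: "finite (children T \<rho> u)"
  using finite_verts by (simp add: children_def)

section \<open>Descendants\<close>

inductive_set desc :: "'a \<Rightarrow> 'a set" for u :: 'a where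
  self [simp]: "u \<in> desc u"
| child: "w \<in> desc u \<Longrightarrow> v \<in> children T \<rho> w \<Longrightarrow> v \<in> desc u"

lemma desc_unfold: "desc u = insert u (\<Union>c\<in>children T \<rho> u. desc c)"
proof
  show "desc u \<subseteq> insert u (\<Union>c\<in>children T \<rho> u. desc c)"
  proof
    show "w \<in> insert u (\<Union>c\<in>children T \<rho> u. desc c)" if "w \<in> desc u" for w
      using that by induction (auto intro: desc.intros)
  qed
  have "w \<in> desc u" if "w \<in> desc c" "c \<in> children T \<rho> u" for w c
    using that by induction (auto intro: desc.intros)
  then show "insert u (\<Union>c\<in>children T \<rho> u. desc c) \<subseteq> desc u"
    by auto
qed

lemma desc_verts: "u \<in> verts T \<Longrightarrow> desc u \<subseteq> verts T"
  by (auto elim: desc.cases dest: children_verts)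

lemma finite_desc: "u \<in> verts T \<Longrightarrow> finite (desc u)"
  using desc_verts finite_verts finite_subset by blast

lemma desc_root: "desc \<rho> = verts T"
proof
  show "verts T \<subseteq> desc \<rho>"
  proof
    fix v assume "v \<in> verts T"
    then show "v \<in> desc \<rho>" by (induction rule: verts_induct) (auto intro: desc.child)
  qed
qed (rule desc_verts[OF root])

lemma dist_desc: "w \<in> desc u \<Longrightarrow> w = u \<or> dist u < dist w"
  by (induction rule: desc.induct) (auto dest: dist_children)

lemma desc_disjoint:
  assumes "w \<in> desc c" "w \<in> desc c'" "dist c = dist c'"
  shows "c = c'"
  using assms(1,2)
proof (induction rule: desc.induct)
  case self
  then show ?case using dist_desc assms(3) by fastforce
next
  case (child y z)
  have "dist c' < dist z"
    using dist_desc[OF child.hyps(1)] dist_children[OF child.hyps(2)] assms(3) by auto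
  then obtain y' where "y' \<in> desc c'" "z \<in> children T \<rho> y'"
    using child.prems by (auto elim: desc.cases)
  then show ?case
    using parent_unique child by blast
qed

lemma separated_desc:
  assumes "dist c = dist c'" "c \<noteq> c'"
  shows "separated (adj T) (desc c) (desc c')"
proof -
  have "\<not> adj T u w" if "u \<in> desc c" "w \<in> desc c'" for u w
    using that desc.child desc_disjoint assms unfolding adj_iff_children by blast
  then show ?thesis
    using desc_disjoint assms by (auto simp: separated_def adj_commute)
qed

lemma pairwise_separated_desc:
  "pairwise (\<lambda>c c'. separated (adj T) (desc c) (desc c')) (children T \<rho> u)"
  "pairwise (\<lambda>c c'. separated (adj T) (desc c - {c}) (desc c' - {c'})) (children T \<rho> u)"
proof -
  show "pairwise (\<lambda>c c'. separated (adj T) (desc c) (desc c')) (children T \<rho> u)"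
    by (auto intro!: pairwiseI separated_desc simp: dist_children)
  then show "pairwise (\<lambda>c c'. separated (adj T) (desc c - {c}) (desc c' - {c'})) (children T \<rho> u)"
    by (rule pairwise_mono) (auto intro: separated_subset)
qed

lemma desc_minus_root: "desc u - {u} = (\<Union>c\<in>children T \<rho> u. desc c)"
proof -
  have "u \<notin> desc c" if "c \<in> children T \<rho> u" for c
    using dist_desc[of u c] dist_children[OF that] by auto
  then show ?thesis by (subst desc_unfold) auto
qed

lemma desc_minus_nbrs: "desc u - insert u {w. adj T u w} = (\<Union>c\<in>children T \<rho> u. desc c - {c})"
proof -
  have "w \<notin> desc u" if "u \<in> children T \<rho> w" for w
    using dist_desc[of w u] dist_children[OF that] by auto
  then have "desc u - insert u {w. adj T u w} = (\<Union>c\<in>children T \<rho> u. desc c) - children T \<rho> u"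
    using desc_minus_root[of u] by (auto simp: adj_iff_children)
  also have "\<dots> = (\<Union>c\<in>children T \<rho> u. desc c - {c})"
  proof -
    have "c' = c" if "c \<in> children T \<rho> u" "c' \<in> children T \<rho> u" "c' \<in> desc c" for c c'
      using that dist_desc[of c' c] by (auto simp: dist_children)
    then show ?thesis by auto
  qed
  finally show ?thesis .
qed

abbreviation desc_sum :: "'b::comm_semiring_1 \<Rightarrow> 'a \<Rightarrow> 'a set \<Rightarrow> 'b" where
  "desc_sum x u \<equiv> indep_sum x (adj T) (desc u)"

abbreviation desc_root_out_sum :: "'b::comm_semiring_1 \<Rightarrow> 'a \<Rightarrow> 'a set \<Rightarrow> 'b" where
  "desc_root_out_sum x u \<equiv> indep_sum x (adj T) (desc u - {u})"

lemma desc_root_out_sum_empty: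
  assumes "u \<in> verts T"
  shows "desc_root_out_sum x u {} = (\<Prod>c\<in>children T \<rho> u. desc_sum x c {})"
  unfolding desc_minus_root
  by (rule indep_sum_UN[OF finite_children _ pairwise_separated_desc(1)])
      (auto intro: finite_desc children_verts)

lemma desc_sum_root:
  assumes "u \<in> verts T"
  shows "desc_sum x u {u} = x * (\<Prod>c\<in>children T \<rho> u. desc_root_out_sum x c {})"
proof -
  have "desc_sum x u {u} = x * indep_sum x (adj T) (desc u - insert u {w. adj T u w}) {}"
    using finite_desc[OF assms] symp_adj by (intro indep_sum_insert) auto
  also have "\<dots> = x * (\<Prod>c\<in>children T \<rho> u. desc_root_out_sum x c {})"
    unfolding desc_minus_nbrs
    by (subst indep_sum_UN[OF finite_children _ pairwise_separated_desc(2)])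
      (auto intro: finite_desc children_verts)
  finally show ?thesis .
qed

lemma desc_root_out_sum_star:
  assumes "u \<in> verts T" "c \<in> children T \<rho> u" "v \<in> desc c"
  shows "desc_root_out_sum x u {v}
    = desc_sum x c {v} * (\<Prod>d\<in>children T \<rho> u - {c}. desc_sum x d {})"
  unfolding desc_minus_root
proof (rule indep_sum_UN_star[OF finite_children _ pairwise_separated_desc(1) assms(2)])
  show "v \<notin> desc d" if "d \<in> children T \<rho> u" "d \<noteq> c" for d
    using that desc_disjoint[OF assms(3)] assms(2) by (auto simp: dist_children)
qed (auto intro: finite_desc children_verts)

lemma desc_sum_star:
  assumes "u \<in> verts T" "c \<in> children T \<rho> u" "v \<in> desc c"
  shows "desc_sum x u {v} = desc_root_out_sum x u {v}
    + x * (desc_root_out_sum x c {v} * (\<Prod>d\<in>children T \<rho> u - {c}. desc_root_out_sum x d {}))"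
proof -
  have "u \<noteq> v"
    using dist_desc[OF assms(3)] dist_children[OF assms(2)] by auto
  then have "desc_sum x u {v}
      = desc_root_out_sum x u {v} + desc_sum x u (insert u {v})"
    using finite_desc[OF assms(1)] by (intro indep_sum_split) auto
  also have "desc_sum x u (insert u {v})
      = x * indep_sum x (adj T) (\<Union>c\<in>children T \<rho> u. desc c - {c}) {v}"
    using finite_desc[OF assms(1)] symp_adj \<open>u \<noteq> v\<close>
    by (subst indep_sum_insert) (auto simp: desc_minus_nbrs)
  also have "indep_sum x (adj T) (\<Union>c\<in>children T \<rho> u. desc c - {c}) {v}
      = desc_root_out_sum x c {v} * (\<Prod>d\<in>children T \<rho> u - {c}. desc_root_out_sum x d {})"
  proof (rule indep_sum_UN_star[OF finite_children _ pairwise_separated_desc(2) assms(2)])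
    show "v \<notin> desc d - {d}" if "d \<in> children T \<rho> u" "d \<noteq> c" for d
      using that desc_disjoint[OF assms(3)] assms(2) by (auto simp: dist_children)
  qed (auto intro: finite_desc children_verts)
  finally show ?thesis .
qed

end

section \<open>Perfect trees\<close>

locale perfect_rooted_tree =
  fixes T :: "'a sgraph" and \<rho> :: 'a and r h :: nat
  assumes perfect: "perfect_tree T \<rho> r h"
begin

sublocale rooted_tree T \<rho>
  using perfect by unfold_locales (auto simp: perfect_tree_def)

definition level :: "'a \<Rightarrow> nat" where
  "level v = h - dist v"

lemma height_pos: "0 < h" and arity_pos: "0 < r"
  using perfect by (auto simp: perfect_tree_def)

lemma leaves_iff_dist: "v \<in> leaves T \<rho> \<longleftrightarrow> v \<in> verts T \<and> Suc (dist v) = h"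
  using perfect by (auto simp: perfect_tree_def)

lemma dist_less_height: "v \<in> verts T \<Longrightarrow> dist v < h"
proof (induction rule: verts_induct)
  case root
  then show ?case by (simp add: height_pos)
next
  case (child u v)
  then have "u \<notin> leaves T \<rho>" by (auto simp: leaves_def)
  then show ?case
    using child dist_children leaves_iff_dist by fastforce
qed

lemma level_root: "level \<rho> = h"
  by (simp add: level_def)

lemma level_leaf: "v \<in> leaves T \<rho> \<Longrightarrow> level v = 1"
  by (auto simp: leaves_iff_dist level_def)

lemma level_pos: "v \<in> verts T \<Longrightarrow> 0 < level v"
  using dist_less_height by (simp add: level_def)

lemma level_children: "c \<in> children T \<rho> u \<Longrightarrow> level u = Suc (level c)"
  using dist_less_height[of c] by (auto simp: level_def dist_children children_verts)

lemma level_desc: "v \<in> desc u \<Longrightarrow> level v \<le> level u"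
  by (induction rule: desc.induct) (auto dest: level_children)

lemma card_children: "u \<in> verts T \<Longrightarrow> 1 < level u \<Longrightarrow> card (children T \<rho> u) = r"
  using perfect level_leaf[of u] by (auto simp: perfect_tree_def)

lemma prod_children:
  assumes "u \<in> verts T" "level u = Suc t" "f 0 = 1"
  shows "(\<Prod>c\<in>children T \<rho> u. f (level c)) = f t ^ r"
proof -
  have "(\<Prod>c\<in>children T \<rho> u. f (level c)) = f t ^ card (children T \<rho> u)"
    using level_children assms(2) by (subst prod.cong[where h = "\<lambda>_. f t"]) auto
  also have "\<dots> = f t ^ r"
  proof (cases t)
    case 0
    then have "children T \<rho> u = {}"
      using assms(2) level_children level_pos children_verts by fastforce
    then show ?thesis by (simp add: 0 assms(3))
  qed (use card_children assms in simp)
  finally show ?thesis .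
qed

lemma prod_siblings:
  assumes "u \<in> verts T" "level u = Suc t" "c \<in> children T \<rho> u"
  shows "(\<Prod>d\<in>children T \<rho> u - {c}. f (level d)) = f t ^ (r - 1)"
proof -
  have "1 < level u"
    using level_children[OF assms(3)] level_pos[of c] children_verts[OF assms(3)] by simp
  then have "card (children T \<rho> u - {c}) = r - 1"
    using card_children assms finite_children by simp
  moreover have "(\<Prod>d\<in>children T \<rho> u - {c}. f (level d)) = (\<Prod>d\<in>children T \<rho> u - {c}. f t)"
    using level_children assms(2) by (intro prod.cong) auto
  ultimately show ?thesis by simp
qed

lemma desc_sums_perfect:
  "u \<in> verts T \<Longrightarrow>
   desc_sum x u {} = tree_sum x r (level u) \<and> desc_root_out_sum x u {} = root_out_sum x r (level u)"
proof (induction "level u" arbitrary: u rule: less_induct)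
  case less
  obtain t where level_u: "level u = Suc t"
    using level_pos[OF less.prems] gr0_conv_Suc by blast
  have IH: "desc_sum x c {} = tree_sum x r (level c)"
    "desc_root_out_sum x c {} = root_out_sum x r (level c)"
    if "c \<in> children T \<rho> u" for c
    using less.hyps[of c] that by (auto simp: level_children children_verts)
  have "desc_root_out_sum x u {} = (\<Prod>c\<in>children T \<rho> u. tree_sum x r (level c))"
    using less.prems IH by (simp add: desc_root_out_sum_empty)
  also have "\<dots> = root_out_sum x r (level u)"
    using prod_children[OF less.prems level_u, of "tree_sum x r"] by (simp add: level_u)
  finally have root_out: "desc_root_out_sum x u {} = root_out_sum x r (level u)" .
  have "desc_sum x u {u} = x * (\<Prod>c\<in>children T \<rho> u. root_out_sum x r (level c))"
    using less.prems IH by (simp add: desc_sum_root)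
  also have "\<dots> = x * root_out_sum x r t ^ r"
    using prod_children[OF less.prems level_u, of "root_out_sum x r"] by simp
  finally have "desc_sum x u {u} = x * root_out_sum x r t ^ r" .
  moreover have "desc_sum x u {} = desc_root_out_sum x u {} + desc_sum x u {u}"
    using finite_desc[OF less.prems] by (intro indep_sum_split) auto
  ultimately show ?case
    by (simp add: root_out level_u)
qed

lemma desc_sum_root_perfect:
  assumes "u \<in> verts T"
  shows "desc_sum x u {u} = star_sum x r (level u) (level u)"
proof -
  obtain t where level_u: "level u = Suc t"
    using level_pos[OF assms] gr0_conv_Suc by blast
  have "desc_sum x u {u} = x * (\<Prod>c\<in>children T \<rho> u. root_out_sum x r (level c))"
    using assms by (simp add: desc_sum_root desc_sums_perfect children_verts)
  then show ?thesis
    using prod_children[OF assms level_u, of "root_out_sum x r"] by (simp add: level_u)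
qed

lemma desc_sums_perfect_star:
  "u \<in> verts T \<Longrightarrow> v \<in> desc u \<Longrightarrow>
   desc_sum x u {v} = star_sum x r (level v) (level u) \<and>
   desc_root_out_sum x u {v} = star_root_out_sum x r (level v) (level u)"
proof (induction "level u" arbitrary: u rule: less_induct)
  case less
  show ?case
  proof (cases "v = u")
    case True
    then show ?thesis
      using less.prems by (simp add: desc_sum_root_perfect indep_sum_not_subset star_root_out_sum_below)
  next
    case False
    then obtain c where branch: "c \<in> children T \<rho> u" "v \<in> desc c"
      using less.prems(2) desc_unfold[of u] by auto
    then have child: "c \<in> verts T" "level u = Suc (level c)"
      by (simp_all add: children_verts level_children)
    then have IH: "desc_sum x c {v} = star_sum x r (level v) (level c)"
      "desc_root_out_sum x c {v} = star_root_out_sum x r (level v) (level c)"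
      using less.hyps[OF _ child(1) branch(2)] by simp_all
    note siblings = prod_siblings[OF less.prems(1) child(2) branch(1)]
    have "desc_sum x d {} = tree_sum x r (level d)"
      "desc_root_out_sum x d {} = root_out_sum x r (level d)"
      if "d \<in> children T \<rho> u" for d
      using desc_sums_perfect[OF children_verts[OF that], of x] by simp_all
    then have others: "(\<Prod>d\<in>children T \<rho> u - {c}. desc_sum x d {}) = out_weight x r (level c)"
      "x * (\<Prod>d\<in>children T \<rho> u - {c}. desc_root_out_sum x d {}) = in_weight x r (level c)"
      using siblings[of "tree_sum x r"] siblings[of "root_out_sum x r"]
      by (simp_all add: out_weight_def in_weight_def)
    have root_out: "desc_root_out_sum x u {v} = star_root_out_sum x r (level v) (level u)"
      using desc_root_out_sum_star[OF less.prems(1) branch, of x] others(1) IH(1)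
      by (simp add: child mult.commute)
    moreover have "desc_sum x u {v} = desc_root_out_sum x u {v}
        + in_weight x r (level c) * star_root_out_sum x r (level v) (level c)"
      unfolding desc_sum_star[OF less.prems(1) branch, of x] IH(2) others(2)[symmetric]
      by (simp only: mult_ac)
    ultimately show ?thesis
      using level_desc[OF branch(2)] by (simp add: child)
  qed
qed

lemma graph_sum_eq_tree_sum: "graph_sum x T {} = tree_sum x r h"
  using desc_sums_perfect[OF root, of x] by (simp add: desc_root level_root)

lemma graph_sum_eq_star_sum: "v \<in> verts T \<Longrightarrow> graph_sum x T {v} = star_sum x r (level v) h"
  using desc_sums_perfect_star[OF root, of v x] by (simp add: desc_root level_root)

lemma graph_sum_leaf: "l \<in> leaves T \<rho> \<Longrightarrow> graph_sum x T {l} = leaf_sum x r h"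
  by (simp add: graph_sum_eq_star_sum level_leaf leaves_iff_dist)

lemma graph_sum_le_leaf_sum: "v \<in> verts T \<Longrightarrow> graph_sum x T {v} \<preceq> leaf_sum x r h"
  using star_sum_le_leaf_sum[OF arity_pos level_pos, of v h x]
  by (simp add: graph_sum_eq_star_sum level_def)

lemma graph_sum_star_le_leaf:
  "v \<in> verts T \<Longrightarrow> l \<in> leaves T \<rho> \<Longrightarrow>
   graph_sum x T {v} \<preceq> graph_sum x T {l}"
  by (simp only: graph_sum_le_leaf_sum graph_sum_leaf)

end

lemma perfect_tree_single_vertex:
  assumes "perfect_tree T \<rho> r 1" "2 \<le> R"
  shows "perfect_tree T \<rho> R 1"
proof -
  interpret perfect_rooted_tree T \<rho> r 1
    by unfold_locales (rule assms(1))
  have no_inner: "verts T - leaves T \<rho> = {}"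
    using dist_less_height by (auto simp: leaves_iff_dist)
  show ?thesis
    using assms unfolding perfect_tree_def no_inner by auto
qed

lemma perfect_tree_arity_cases:
  assumes "perfect_tree T \<rho> r h" "r \<le> R"
  shows "perfect_tree T \<rho> R h \<or> r < R \<and> 2 \<le> h"
proof (cases "h = 1")
  case True
  then show ?thesis
    using assms perfect_tree_single_vertex[of T \<rho> r R] by (auto simp: perfect_tree_def[of T \<rho> r])
next
  case False
  then show ?thesis
    using assms by (cases "r = R") (auto simp: perfect_tree_def[of T \<rho> r])
qed

lemma perfect_tree_leaf_le:
  assumes "perfect_tree T \<rho> r g" "r \<le> R" "perfect_tree T \<rho> R g \<Longrightarrow> leaf_height_le g h"
  shows "\<exists>s. perfect_tree T \<rho> s g \<and> leaf_le s g R h"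
  using perfect_tree_arity_cases[OF assms(1,2)] assms(1,3) by (auto simp: leaf_le_def)

lemma perfect_tree_star_le_leaf:
  assumes "perfect_tree S \<sigma> s g" "perfect_tree T \<rho> r h" "v \<in> verts S" "l \<in> leaves T \<rho>"
    and "leaf_le s g r h"
  shows "graph_sum x S {v} * graph_sum x T {} \<preceq> graph_sum x T {l} * graph_sum x S {}"
proof -
  interpret S: perfect_rooted_tree S \<sigma> s g by unfold_locales (rule assms(1))
  interpret T: perfect_rooted_tree T \<rho> r h by unfold_locales (rule assms(2))
  have "graph_sum x S {v} * tree_sum x r h \<preceq> leaf_sum x s g * tree_sum x r h"
    using S.graph_sum_le_leaf_sum[OF assms(3)] by (intro natural_le_mult_mono natural_le_refl)
  also have "\<dots> \<preceq> leaf_sum x r h * tree_sum x s g"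
    using assms(5) by (intro leaf_sum_mono S.arity_pos T.arity_pos S.height_pos T.height_pos)
  finally show ?thesis
    by (simp only: S.graph_sum_eq_tree_sum T.graph_sum_eq_tree_sum T.graph_sum_leaf[OF assms(4)])
qed

section \<open>Components\<close>

lemma walk_imp_rtranclp: "walk G p \<Longrightarrow> (adj G)\<^sup>*\<^sup>* (hd p) (last p)"
proof (induction p rule: rev_induct)
  case Nil
  then show ?case by (simp add: walk_def)
next
  case (snoc v p)
  then show ?case
    by (cases "p = []") (auto simp: walk_snoc intro: rtranclp.rtrancl_into_rtrancl)
qed

lemma rtranclp_imp_walk:
  assumes "simple_graph G" "(adj G)\<^sup>*\<^sup>* u v" "u \<in> verts G"
  shows "\<exists>p. walk G p \<and> hd p = u \<and> last p = v"
  using assms(2)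
proof (induction rule: rtranclp_induct)
  case base
  then show ?case using assms(3) by (intro exI[of _ "[u]"]) (simp add: walk_def)
next
  case (step v w)
  then obtain p where walk: "walk G p" "hd p = u" "last p = v" by blast
  then have "p \<noteq> []" by (auto simp: walk_def)
  then show ?case
    using walk step.hyps(2) adj_verts[OF assms(1) step.hyps(2)]
    by (intro exI[of _ "p @ [w]"]) (simp add: walk_snoc)
qed

lemma graph_connected_iff_rtranclp:
  assumes "simple_graph G"
  shows "graph_connected G \<longleftrightarrow> verts G \<noteq> {} \<and> (\<forall>u\<in>verts G. \<forall>v\<in>verts G. (adj G)\<^sup>*\<^sup>* u v)"
proof -
  have "(\<exists>p. walk G p \<and> hd p = u \<and> last p = v) \<longleftrightarrow> (adj G)\<^sup>*\<^sup>* u v" if "u \<in> verts G" for u v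
    using rtranclp_imp_walk[OF assms _ that] walk_imp_rtranclp[of G] by auto
  then show ?thesis by (simp add: graph_connected_def)
qed

lemma rtranclp_adj_sym: "(adj G)\<^sup>*\<^sup>* u v \<Longrightarrow> (adj G)\<^sup>*\<^sup>* v u"
  using symp_rtranclp[OF symp_adj] by (rule sympD)

lemma rtranclp_adj_verts:
  assumes "simple_graph G" "(adj G)\<^sup>*\<^sup>* u v" "u \<in> verts G"
  shows "v \<in> verts G"
  using assms(2,3) by (induction rule: rtranclp_induct) (auto dest: adj_verts[OF assms(1)])

definition component_of :: "'a sgraph \<Rightarrow> 'a \<Rightarrow> 'a sgraph" where
  "component_of G v = SGraph {u. (adj G)\<^sup>*\<^sup>* v u} {e \<in> edges G. e \<subseteq> {u. (adj G)\<^sup>*\<^sup>* v u}}"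

lemma verts_component_of: "verts (component_of G v) = {u. (adj G)\<^sup>*\<^sup>* v u}"
  by (simp add: component_of_def)

lemma adj_component_of: "adj (component_of G v) u w \<longleftrightarrow> adj G u w \<and> (adj G)\<^sup>*\<^sup>* v u \<and> (adj G)\<^sup>*\<^sup>* v w"
  by (auto simp: component_of_def adj_def)

lemma component_of_subgraph:
  assumes "simple_graph G" "v \<in> verts G"
  shows "subgraph (component_of G v) G"
proof -
  have "{u. (adj G)\<^sup>*\<^sup>* v u} \<subseteq> verts G"
    using rtranclp_adj_verts[OF assms(1) _ assms(2)] by auto
  moreover from this have "finite {u. (adj G)\<^sup>*\<^sup>* v u}"
    using assms(1) by (auto simp: simple_graph_def intro: finite_subset)
  ultimately show ?thesis
    using assms(1) by (auto simp: subgraph_def simple_graph_def component_of_def)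
qed

lemma component_of_connected:
  assumes "simple_graph G" "v \<in> verts G"
  shows "graph_connected (component_of G v)"
proof -
  let ?C = "component_of G v"
  have from_v: "(adj ?C)\<^sup>*\<^sup>* v u" if "(adj G)\<^sup>*\<^sup>* v u" for u
    using that
  proof (induction rule: rtranclp_induct)
    case (step y z)
    then have "adj ?C y z" by (auto simp: adj_component_of)
    with step.IH show ?case by (rule rtranclp.rtrancl_into_rtrancl)
  qed simp
  have "(adj ?C)\<^sup>*\<^sup>* u w" if "(adj G)\<^sup>*\<^sup>* v u" "(adj G)\<^sup>*\<^sup>* v w" for u w
    using rtranclp_trans[OF rtranclp_adj_sym[OF from_v] from_v] that by blast
  moreover have "simple_graph ?C"
    using component_of_subgraph[OF assms] by (simp add: subgraph_def)
  ultimately show ?thesis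
    by (auto simp: graph_connected_iff_rtranclp verts_component_of)
qed

lemma connected_subgraph_component_of:
  assumes "subgraph H G" "graph_connected H" "v \<in> verts H"
  shows "subgraph H (component_of G v)"
proof -
  have sub: "simple_graph H" "adj H \<le> adj G"
    using assms(1) by (auto simp: subgraph_def adj_def)
  then have "(adj G)\<^sup>*\<^sup>* v u" if "u \<in> verts H" for u
    using assms(2,3) that rtranclp_mono[OF sub(2)] by (auto simp: graph_connected_iff_rtranclp)
  then show ?thesis
    using assms(1) by (auto simp: subgraph_def component_of_def simple_graph_def)
qed

lemma graph_components_eq:
  assumes "simple_graph G"
  shows "graph_components G = component_of G ` verts G"
proof
  show "graph_components G \<subseteq> component_of G ` verts G"
  proof
    fix H assume comp: "H \<in> graph_components G"
    then obtain v where "v \<in> verts H" "v \<in> verts G"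
      by (auto simp: graph_components_def graph_connected_def subgraph_def)
    moreover from this have "H = component_of G v"
      using comp component_of_subgraph[OF assms] component_of_connected[OF assms]
        connected_subgraph_component_of by (force simp: graph_components_def)
    ultimately show "H \<in> component_of G ` verts G" by blast
  qed
  have "H = component_of G v"
    if "v \<in> verts G" "subgraph H G" "graph_connected H" "subgraph (component_of G v) H" for v H
  proof -
    have "v \<in> verts H"
      using that(4) by (auto simp: subgraph_def verts_component_of)
    then have "subgraph H (component_of G v)"
      using that by (intro connected_subgraph_component_of)
    then show ?thesis
      using that(4) by (intro sgraph.expand) (auto simp: subgraph_def)
  qed
  then show "component_of G ` verts G \<subseteq> graph_components G"
    using component_of_subgraph[OF assms] component_of_connected[OF assms]
    by (auto simp: graph_components_def)
qed

lemma component_of_cong: "(adj G)\<^sup>*\<^sup>* u v \<Longrightarrow> component_of G u = component_of G v"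
proof -
  assume "(adj G)\<^sup>*\<^sup>* u v"
  then have "(adj G)\<^sup>*\<^sup>* u = (adj G)\<^sup>*\<^sup>* v"
    by (intro ext) (blast intro: rtranclp_trans rtranclp_adj_sym)
  then show ?thesis by (simp add: component_of_def)
qed

context
  fixes G :: "'a sgraph"
  assumes simple: "simple_graph G"
begin

lemma verts_eq_Union_components: "verts G = (\<Union>H\<in>graph_components G. verts H)"
  using rtranclp_adj_verts[OF simple] by (auto simp: graph_components_eq[OF simple] verts_component_of)

lemma component_eq_component_of: "H \<in> graph_components G \<Longrightarrow> v \<in> verts H \<Longrightarrow> H = component_of G v"
  by (auto simp: graph_components_eq[OF simple] verts_component_of intro: component_of_cong)

lemma adj_component:
  assumes "H \<in> graph_components G" "u \<in> verts H" "w \<in> verts H"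
  shows "adj H u w \<longleftrightarrow> adj G u w"
  using assms by (auto simp: graph_components_eq[OF simple] verts_component_of adj_component_of)

lemma pairwise_separated_components:
  "pairwise (\<lambda>H K. separated (adj G) (verts H) (verts K)) (graph_components G)"
proof (rule pairwiseI)
  fix H K assume HK: "H \<in> graph_components G" "K \<in> graph_components G" "H \<noteq> K"
  have apart: "\<not> (adj G)\<^sup>*\<^sup>* u w" if "u \<in> verts H" "w \<in> verts K" for u w
    using that HK component_eq_component_of component_of_cong by metis
  then show "separated (adj G) (verts H) (verts K)"
    unfolding separated_def by (auto simp: adj_commute)
qed

lemma graph_sum_star_components:
  assumes "H \<in> graph_components G" "v \<in> verts H"
  shows "graph_sum x G {v} = graph_sum x H {v} * (\<Prod>K\<in>graph_components G - {H}. graph_sum x K {})"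
proof -
  have finite: "finite (verts K)" if "K \<in> graph_components G" for K
    using that by (auto simp: graph_components_def subgraph_def simple_graph_def)
  have "finite (graph_components G)"
    using simple by (simp add: graph_components_eq simple_graph_def)
  moreover have "v \<notin> verts K" if "K \<in> graph_components G" "K \<noteq> H" for K
    using that assms component_eq_component_of by blast
  ultimately have "graph_sum x G {v} =
      indep_sum x (adj G) (verts H) {v} * (\<Prod>K\<in>graph_components G - {H}. indep_sum x (adj G) (verts K) {})"
    unfolding verts_eq_Union_components
    by (intro indep_sum_UN_star finite pairwise_separated_components assms(1))
  moreover have "indep_sum x (adj G) (verts K) C = graph_sum x K C"
    if "K \<in> graph_components G" for K C
    using adj_component[OF that] by (intro indep_sum_cong) simp
  ultimately show ?thesis using assms(1) by simp
qed

lemma graph_sum_star_mono_components: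
  assumes "H \<in> graph_components G" "K \<in> graph_components G" "v \<in> verts H" "w \<in> verts K"
    and same: "H = K \<Longrightarrow> graph_sum x H {v} \<preceq> graph_sum x K {w}"
    and other: "graph_sum x H {v} * graph_sum x K {} \<preceq> graph_sum x K {w} * graph_sum x H {}"
  shows "graph_sum x G {v} \<preceq> graph_sum x G {w}"
proof (cases "H = K")
  case True
  then show ?thesis
    using assms(1-4) same by (simp add: graph_sum_star_components natural_le_mult_mono)
next
  case False
  let ?rest = "\<Prod>L\<in>graph_components G - {H} - {K}. graph_sum x L {}"
  have swap: "graph_components G - {K} - {H} = graph_components G - {H} - {K}"
    by blast
  have "finite (graph_components G)"
    using simple by (simp add: graph_components_eq simple_graph_def)
  then have "(\<Prod>L\<in>graph_components G - {H}. graph_sum x L {}) = graph_sum x K {} * ?rest"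
    "(\<Prod>L\<in>graph_components G - {K}. graph_sum x L {}) = graph_sum x H {} * ?rest"
    using False assms(1,2) prod.remove[of "graph_components G - {H}" K]
      prod.remove[of "graph_components G - {K}" H]
    by (simp_all add: swap)
  then have "graph_sum x G {v} = graph_sum x H {v} * graph_sum x K {} * ?rest"
    "graph_sum x G {w} = graph_sum x K {w} * graph_sum x H {} * ?rest"
    using assms(1-4) by (simp_all add: graph_sum_star_components mult.assoc)
  then show ?thesis
    using other by (simp add: natural_le_mult_mono)
qed

end

section \<open>The best leaf\<close>

definition best_index :: "(nat \<Rightarrow> nat) \<Rightarrow> nat \<Rightarrow> nat" where
  "best_index h m = (if \<forall>i\<in>{1..m}. even (h i) then m else LEAST j. j \<in> {1..m} \<and> odd (h j))"

lemma best_index: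
  assumes "1 \<le> m" and mono: "mono_on {1..m} h"
  shows "best_index h m \<in> {1..m}"
    and "i \<in> {1..m} \<Longrightarrow> leaf_height_le (h i) (h (best_index h m))"
proof -
  have "best_index h m \<in> {1..m} \<and> (\<forall>i\<in>{1..m}. leaf_height_le (h i) (h (best_index h m)))"
  proof (cases "\<forall>i\<in>{1..m}. even (h i)")
    case True
    moreover have "leaf_height_le (h i) (h m)" if "i \<in> {1..m}" for i
      using that True mono_onD[OF mono, of i m] by (auto simp: leaf_height_le_def)
    ultimately show ?thesis
      using assms(1) by (simp add: best_index_def)
  next
    case False
    define j where "j = (LEAST j. j \<in> {1..m} \<and> odd (h j))"
    have least: "j \<in> {1..m}" "odd (h j)"
      using False LeastI_ex[of "\<lambda>j. j \<in> {1..m} \<and> odd (h j)"] unfolding j_def by blast+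
    have "leaf_height_le (h i) (h j)" if index: "i \<in> {1..m}" for i
    proof (cases "h i < h j")
      case True
      then have "i < j" using mono_onD[OF mono, of j i] index least by force
      then have "even (h i)" using not_less_Least[of i] index unfolding j_def by blast
      then show ?thesis using True by (simp add: leaf_height_le_def)
    qed (use least in \<open>auto simp: leaf_height_le_def\<close>)
    moreover have "best_index h m = j"
      unfolding best_index_def j_def by (rule if_not_P[OF False])
    ultimately show ?thesis
      using least(1) by simp
  qed
  then show "best_index h m \<in> {1..m}" and "i \<in> {1..m} \<Longrightarrow> leaf_height_le (h i) (h (best_index h m))"
    by blast+
qed

lemma card_indep_star_eq_coeff:
  assumes "finite (verts G)"
  shows "card (indep_star G k v) = coeff (graph_sum (monom 1 1) G {v}) k"
proof -
  have "indep_star G k v = {A \<in> indep_family (adj G) (verts G) {v}. card A = k}"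
    by (auto simp: indep_star_def indep_sets_def indep_family_def)
  then show ?thesis by (simp only: coeff_indep_sum_X[OF assms] of_nat_id)
qed

lemma card_indep_star_le_leaf:
  assumes "simple_graph G" "H \<in> graph_components G" "K \<in> graph_components G"
    and "perfect_tree H \<sigma> s g" "perfect_tree K \<rho> r h" "leaf_le s g r h"
    and "v \<in> verts H" "l \<in> leaves K \<rho>"
  shows "card (indep_star G k v) \<le> card (indep_star G k l)"
proof -
  let ?x = "monom 1 1 :: nat poly"
  have l_vert: "l \<in> verts K" using assms(8) by (simp add: leaves_def)
  have "graph_sum ?x H {v} \<preceq> graph_sum ?x K {l}" if "H = K"
    using perfect_rooted_tree.graph_sum_star_le_leaf[OF perfect_rooted_tree.intro[OF assms(5)] _ assms(8)]
      assms(7) that by simp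
  then have "graph_sum ?x G {v} \<preceq> graph_sum ?x G {l}"
    using assms(1-3,7) l_vert perfect_tree_star_le_leaf[OF assms(4,5,7,8,6)]
    by (intro graph_sum_star_mono_components)
  moreover have "finite (verts G)"
    using assms(1) by (simp add: simple_graph_def)
  ultimately show ?thesis
    by (simp add: card_indep_star_eq_coeff coeff_mono)
qed

theorem theorem2:
  fixes G :: "'a sgraph" and T :: "nat \<Rightarrow> 'a sgraph" and \<rho> :: "nat \<Rightarrow> 'a"
    and r h :: "nat \<Rightarrow> nat" and n m k :: nat and l v :: 'a
  assumes forest: "graph_forest G"
    and components: "bij_betw T {1..n} (graph_components G)"
    and perfect: "\<And>i. i \<in> {1..n} \<Longrightarrow> perfect_tree (T i) (\<rho> i) (r i) (h i)"
    and highest: "{1..m} = {i \<in> {1..n}. perfect_tree (T i) (\<rho> i) (Max (r ` {1..n})) (h i)}"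
    and sorted: "\<And>i j. 1 \<le> i \<Longrightarrow> i \<le> j \<Longrightarrow> j \<le> m \<Longrightarrow> h i \<le> h j"
    and leaf: "if \<forall>i \<in> {1..m}. even (h i)
               then l \<in> leaves (T m) (\<rho> m)
               else (let j = (LEAST j. j \<in> {1..m} \<and> odd (h j)) in l \<in> leaves (T j) (\<rho> j))"
    and "k > 0"
    and "v \<in> verts G"
  shows "card (indep_star G k v) \<le> card (indep_star G k l)"
proof -
  let ?R = "Max (r ` {1..n})" and ?b = "best_index h m"
  have simple: "simple_graph G" using forest by (simp add: graph_forest_def)
  have comps: "graph_components G = T ` {1..n}" using components by (simp add: bij_betw_def)
  obtain a where v_tree: "a \<in> {1..n}" "v \<in> verts (T a)"
    using \<open>v \<in> verts G\<close> unfolding verts_eq_Union_components[OF simple] comps by blast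
  have "?R \<in> r ` {1..n}" using v_tree by (intro Max_in) auto
  then obtain i where "i \<in> {1..n}" "r i = ?R" by (metis imageE)
  then have "i \<in> {1..m}" unfolding highest using perfect[of i] by simp
  then have "1 \<le> m" by simp
  moreover have "mono_on {1..m} h" by (rule mono_onI) (simp add: sorted)
  ultimately have best: "?b \<in> {1..m}" "\<And>i. i \<in> {1..m} \<Longrightarrow> leaf_height_le (h i) (h ?b)"
    by (rule best_index)+
  have best_tree: "?b \<in> {1..n}" "perfect_tree (T ?b) (\<rho> ?b) ?R (h ?b)"
    using best(1) highest by blast+
  have l_leaf: "l \<in> leaves (T ?b) (\<rho> ?b)"
    using leaf by (simp add: best_index_def Let_def split: if_splits)
  have "a \<in> {1..m}" if "perfect_tree (T a) (\<rho> a) ?R (h a)"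
    unfolding highest using that v_tree(1) by simp
  then obtain s where worse: "perfect_tree (T a) (\<rho> a) s (h a)" "leaf_le s (h a) ?R (h ?b)"
    using perfect_tree_leaf_le[OF perfect[OF v_tree(1)], of ?R "h ?b"] v_tree(1) best(2) by auto
  have "T a \<in> graph_components G" "T ?b \<in> graph_components G"
    using v_tree(1) best_tree(1) by (simp_all add: comps)
  then show ?thesis
    by (rule card_indep_star_le_leaf[OF simple _ _ worse(1) best_tree(2) worse(2) v_tree(2) l_leaf])
qed

end
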